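(* Let $E$ be a Banach lattice. Every uo-demi Dunford–Pettis operator $T:E\to E$ is demi Dunford–Pettis.
   Context: All Banach lattices are real; "operator" means bounded linear map. A net $(x_\alpha)$ in a Banach lattice $E$ is uo-convergent (unbounded order convergent) to $x$ if $|x_\alpha-x|\wedge y$ converges in order to $0$ for every $y\in E^+$. An operator $T:E\to E$ on a Banach lattice $E$ is uo-demi Dunford–Pettis (unbounded order demi Dunford–Pettis) if for every weakly null sequence $(x_n)$ in $E$ such that $(x_n-T(x_n))$ is uo-convergent to $0$, one has $\|x_n\|\to0$. An operator $T:X\to X$ on a Banach space $X$ is demi Dunford–Pettis if for every weakly null sequence $(x_n)$ in $X$ with $\|x_n-T(x_n)\|\to0$, one has $\|x_n\|\to0$. *)

theory Defs
  imports "HOL-Analysis.Analysis" "HOL-Library.Lattice_Algebras"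
begin

(* The class lattice_ab_group_add_abs contributes the lattice operations and |x| = sup x (-x). *)
class banach_lattice = banach + ordered_real_vector + lattice_ab_group_add_abs +
  assumes norm_mono_abs: "\<bar>x\<bar> \<le> \<bar>y\<bar> \<Longrightarrow> norm x \<le> norm y"

instance real :: banach_lattice
  by standard simp

definition directed_on :: "'i set \<Rightarrow> 'i rel \<Rightarrow> bool" where
  "directed_on I r \<longleftrightarrow>
     I \<noteq> {} \<and> preorder_on I r \<and> (\<forall>i\<in>I. \<forall>j\<in>I. \<exists>k\<in>I. (i, k) \<in> r \<and> (j, k) \<in> r)"

(* The net (y i), i in I, is decreasing and has infimum 0. *)
definition net_decreases_to_0 ::
    "'i set \<Rightarrow> 'i rel \<Rightarrow> ('i \<Rightarrow> 'a::{ab_group_add, order}) \<Rightarrow> bool" where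
  "net_decreases_to_0 I r y \<longleftrightarrow>
     directed_on I r \<and>
     (\<forall>i j. (i, j) \<in> r \<longrightarrow> y j \<le> y i) \<and>
     (\<forall>i\<in>I. 0 \<le> y i) \<and> (\<forall>z. (\<forall>i\<in>I. z \<le> y i) \<longrightarrow> z \<le> 0)"

(* Nets are families along a filter; a sequence is the case F = sequentially.  The dominating net
   may have an index set different from that of x.  HOL cannot quantify over index types, so the
   index set is taken inside the lattice; order_convergesI below shows that this loses nothing. *)
definition order_converges :: "('b \<Rightarrow> 'a::banach_lattice) \<Rightarrow> 'a \<Rightarrow> 'b filter \<Rightarrow> bool" where
  "order_converges x l F \<longleftrightarrow>
     (\<exists>(I :: 'a set) r y. net_decreases_to_0 I r y \<and>
        (\<forall>i\<in>I. \<forall>\<^sub>F a in F. \<bar>x a - l\<bar> \<le> y i))"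

lemma order_convergesI:
  fixes x :: "'b \<Rightarrow> 'a::banach_lattice" and I :: "'i set" and y :: "'i \<Rightarrow> 'a"
  assumes y: "net_decreases_to_0 I r y"
    and dom: "\<forall>i\<in>I. \<forall>\<^sub>F a in F. \<bar>x a - l\<bar> \<le> y i"
  shows "order_converges x l F"
proof -
  define s where "s = {(u, v). u \<in> y ` I \<and> v \<in> y ` I \<and> v \<le> u}"
  have "preorder_on (y ` I) s"
    by (auto simp: preorder_on_def refl_on_def trans_def s_def)
  moreover have "\<exists>k\<in>I. y k \<le> y i \<and> y k \<le> y j" if "i \<in> I" "j \<in> I" for i j
    using y that unfolding net_decreases_to_0_def directed_on_def by meson
  ultimately have "directed_on (y ` I) s"
    using y by (auto simp: net_decreases_to_0_def directed_on_def s_def)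
  then have "net_decreases_to_0 (y ` I) s (\<lambda>u. u)"
    using y by (auto simp: net_decreases_to_0_def s_def)
  moreover have "\<forall>u\<in>y ` I. \<forall>\<^sub>F a in F. \<bar>x a - l\<bar> \<le> u"
    using dom by auto
  ultimately show ?thesis
    unfolding order_converges_def by blast
qed

definition uo_converges :: "('b \<Rightarrow> 'a::banach_lattice) \<Rightarrow> 'a \<Rightarrow> 'b filter \<Rightarrow> bool" where
  "uo_converges x l F \<longleftrightarrow> (\<forall>y\<ge>0. order_converges (\<lambda>a. inf \<bar>x a - l\<bar> y) 0 F)"

definition weakly_null :: "(nat \<Rightarrow> 'a::real_normed_vector) \<Rightarrow> bool" where
  "weakly_null x \<longleftrightarrow> (\<forall>f :: 'a \<Rightarrow> real. bounded_linear f \<longrightarrow> (\<lambda>n. f (x n)) \<longlonglongrightarrow> 0)"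

definition uo_demi_dunford_pettis :: "('a::banach_lattice \<Rightarrow> 'a) \<Rightarrow> bool" where
  "uo_demi_dunford_pettis T \<longleftrightarrow>
     bounded_linear T \<and>
     (\<forall>x. weakly_null x \<and> uo_converges (\<lambda>n. x n - T (x n)) 0 sequentially
        \<longrightarrow> (\<lambda>n. norm (x n)) \<longlonglongrightarrow> 0)"

definition demi_dunford_pettis :: "('a::banach \<Rightarrow> 'a) \<Rightarrow> bool" where
  "demi_dunford_pettis T \<longleftrightarrow>
     bounded_linear T \<and>
     (\<forall>x. weakly_null x \<and> (\<lambda>n. norm (x n - T (x n))) \<longlonglongrightarrow> 0
        \<longrightarrow> (\<lambda>n. norm (x n)) \<longlonglongrightarrow> 0)"

end

(* A norm-null sequence has an absolutely summable subsequence, which is dominated by the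
   remainders of the series of its absolute values.  These remainders decrease to 0 in order
   because they are norm-null, so the subsequence is uo-null.  If x is weakly null with
   x - T x norm-null but x is not norm-null, the operator property applied to such a
   subsequence, along which the norms of x stay away from 0, gives a contradiction. *)
theory Submission
  imports Defs
begin

lemma banach_lattice_norm_abs:
  fixes x :: "'a::banach_lattice"
  shows "norm \<bar>x\<bar> = norm x"
  by (intro antisym norm_mono_abs) simp_all

lemma banach_lattice_norm_mono:
  fixes x y :: "'a::banach_lattice"
  assumes "0 \<le> x" "x \<le> y"
  shows "norm x \<le> norm y"
  using assms by (intro norm_mono_abs) (simp add: order_trans[OF assms])

text \<open>The positive part \<open>sup x 0\<close> lies below every \<open>y n\<close>, so by
  monotonicity of the norm its norm is at most the limit 0. This is the passage from norm limits to
  order bounds.\<close>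

lemma le_0_if_le_norm_null:
  fixes x :: "'a::banach_lattice"
  assumes le: "\<And>n. x \<le> y n" and pos: "\<And>n. 0 \<le> y n" and lim: "y \<longlonglongrightarrow> 0"
  shows "x \<le> 0"
proof -
  have "norm (sup x 0) \<le> norm (y n)" for n
    using le pos by (intro banach_lattice_norm_mono) simp_all
  moreover have "(\<lambda>n. norm (y n)) \<longlonglongrightarrow> 0"
    using lim by (rule tendsto_norm_zero)
  ultimately have "norm (sup x 0) \<le> 0"
    by (intro LIMSEQ_le_const) auto
  then have "sup x 0 = 0"
    by (simp only: norm_le_zero_iff)
  then show ?thesis
    by (simp only: sup.absorb_iff2)
qed

text \<open>As \<open>x n\<close> is positive, \<open>- l\<close> lies below \<open>x n - l\<close>
  and so below \<open>\<bar>x n - l\<bar>\<close>, whose norm is that of \<open>x n - l\<close> and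
  tends to 0; hence \<open>- l \<le> 0\<close>.\<close>

lemma banach_lattice_lim_nonneg:
  fixes x :: "nat \<Rightarrow> 'a::banach_lattice"
  assumes pos: "\<And>n. 0 \<le> x n" and lim: "x \<longlonglongrightarrow> l"
  shows "0 \<le> l"
proof -
  have "- l \<le> \<bar>x n - l\<bar>" for n
    using diff_right_mono[OF pos[of n], of l] abs_ge_self[of "x n - l"]
    by (simp only: diff_0 order_trans)
  moreover have "(\<lambda>n. \<bar>x n - l\<bar>) \<longlonglongrightarrow> 0"
    by (rule tendsto_norm_zero_cancel)
      (simp add: banach_lattice_norm_abs tendsto_norm_zero[OF LIM_zero[OF lim]])
  ultimately have "- l \<le> 0"
    by (rule le_0_if_le_norm_null[OF _ abs_ge_zero])
  then show ?thesis by simp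
qed

lemma banach_lattice_suminf_nonneg:
  fixes f :: "nat \<Rightarrow> 'a::banach_lattice"
  assumes "\<And>n. 0 \<le> f n" "summable f"
  shows "0 \<le> suminf f"
proof (rule banach_lattice_lim_nonneg)
  show "0 \<le> sum f {..<n}" for n
    using assms(1) by (rule sum_nonneg)
  show "(\<lambda>n. sum f {..<n}) \<longlonglongrightarrow> suminf f"
    using assms(2) by (rule summable_LIMSEQ)
qed

lemma uo_converges_0_if_summable_norm:
  fixes y :: "nat \<Rightarrow> 'a::banach_lattice"
  assumes "summable (\<lambda>n. norm (y n))"
  shows "uo_converges y 0 sequentially"
proof -
  define z where "z m = (\<Sum>k. \<bar>y (k + m)\<bar>)" for m
  have sm: "summable (\<lambda>n. \<bar>y n\<bar>)"
    by (rule summable_norm_cancel) (simp add: banach_lattice_norm_abs assms)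
  then have sm': "summable (\<lambda>k. \<bar>y (k + m)\<bar>)" for m
    by (rule summable_ignore_initial_segment)
  have z_nonneg: "0 \<le> z m" for m
    unfolding z_def by (rule banach_lattice_suminf_nonneg) (simp_all add: sm')
  \<comment> \<open>Splitting off the first term gives both the monotonicity of the remainders and
    the bound of \<open>\<bar>y n\<bar>\<close> by \<open>z n\<close>.\<close>
  have z_Suc: "z m = \<bar>y m\<bar> + z (Suc m)" for m
    unfolding z_def using suminf_split_head[OF sm'[of m]] by (simp add: algebra_simps)
  have "z (Suc m) \<le> z m" for m
    by (subst (2) z_Suc) simp
  then have z_anti: "z n \<le> z m" if "m \<le> n" for m n
    using that by (rule lift_Suc_antimono_le)
  have y_le_z: "\<bar>y n\<bar> \<le> z m" if "m \<le> n" for m n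
  proof -
    have "\<bar>y n\<bar> \<le> z n"
      by (subst z_Suc) (simp add: z_nonneg)
    then show ?thesis
      using z_anti[OF that] by (rule order_trans)
  qed
  have z_lim: "z \<longlonglongrightarrow> 0"
    unfolding z_def by (rule suminf_exist_split2[OF sm])
  have "\<exists>k. i \<le> k \<and> j \<le> k" for i j :: nat
    by (rule exI[of _ "max i j"]) simp
  then have "directed_on UNIV {(m, n). m \<le> (n::nat)}"
    by (simp add: directed_on_def preorder_on_def refl_on_def trans_def)
  \<comment> \<open>The infimum is 0 because a common lower bound of the remainders lies below a
    norm-null sequence of positive elements.\<close>
  then have dec: "net_decreases_to_0 UNIV {(m, n). m \<le> n} z"
    unfolding net_decreases_to_0_def
    using z_anti z_nonneg le_0_if_le_norm_null[OF _ _ z_lim] by auto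
  have "order_converges (\<lambda>n. inf \<bar>y n - 0\<bar> u) 0 sequentially" if "0 \<le> u" for u
  proof (rule order_convergesI[OF dec], intro ballI)
    fix m
    \<comment> \<open>Truncation by \<open>u\<close> only lowers \<open>\<bar>y n\<bar>\<close>, so
      the same net \<open>z\<close> serves every \<open>u\<close>; its member \<open>z m\<close>
      dominates from \<open>n = m\<close> on.\<close>
    have "\<bar>(inf (\<bar>y n - 0\<bar>) u) - 0\<bar> \<le> z m" if "m \<le> n" for n
      using \<open>0 \<le> u\<close> y_le_z[OF that] by (simp add: le_infI1)
    then show "\<forall>\<^sub>F n in sequentially. \<bar>(inf (\<bar>y n - 0\<bar>) u) - 0\<bar> \<le> z m"
      by (auto simp: eventually_sequentially)
  qed
  then show ?thesis
    by (simp add: uo_converges_def)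
qed

text \<open>Indices with \<open>P\<close> occur arbitrarily late, where \<open>norm (y n)\<close> is
  already below any prescribed power of 1/2. Carrying \<open>P\<close> along lets the subsequence
  keep a property unrelated to \<open>y\<close>.\<close>

lemma frequently_subseq_summable_norm:
  fixes y :: "nat \<Rightarrow> 'a::real_normed_vector"
  assumes lim: "y \<longlonglongrightarrow> 0" and freq: "\<exists>\<^sub>F n in sequentially. P n"
  obtains r where "strict_mono r" "\<And>n. P (r n)" "summable (\<lambda>n. norm (y (r n)))"
proof -
  have next_index: "\<exists>n>N. P n \<and> norm (y n) < (1/2) ^ k" for N k
  proof -
    have "\<forall>\<^sub>F n in sequentially. norm (y n) < (1/2) ^ k"
      using tendsto_norm_zero[OF lim] by (rule order_tendstoD) simp
    then have "\<forall>\<^sub>F n in sequentially. n > N \<and> norm (y n) < (1/2) ^ k"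
      using eventually_gt_at_top[of N] by eventually_elim simp
    from frequently_ex[OF frequently_eventually_frequently[OF freq this]]
    show ?thesis by auto
  qed
  \<comment> \<open>Dependent choice: \<open>next_index\<close> with \<open>N = r k\<close> supplies
    \<open>r (Suc k)\<close>, and the bounds \<open>(1/2) ^ k\<close> form a geometric
    majorant.\<close>
  have "\<exists>r. \<forall>k. (P (r k) \<and> norm (y (r k)) < (1/2) ^ k) \<and> r k < r (Suc k)"
    by (rule dependent_nat_choice) (use next_index in blast)+
  then obtain r where r: "\<And>k. P (r k)" "\<And>k. norm (y (r k)) < (1/2) ^ k" "\<And>k. r k < r (Suc k)"
    by blast
  show ?thesis
  proof
    show "strict_mono r"
      using r(3) by (simp add: strict_mono_Suc_iff)
    show "P (r n)" for n
      by (rule r)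
    show "summable (\<lambda>n. norm (y (r n)))"
      by (rule summable_comparison_test'[OF summable_geometric[of "1/2::real"]])
        (use r(2) in \<open>auto intro: less_imp_le\<close>)
  qed
qed

theorem proposition3p1:
  fixes T :: "'a::banach_lattice \<Rightarrow> 'a"
  assumes "uo_demi_dunford_pettis T"
  shows "demi_dunford_pettis T"
  unfolding demi_dunford_pettis_def
proof (intro conjI allI impI)
  show "bounded_linear T"
    using assms by (simp add: uo_demi_dunford_pettis_def)
next
  fix x :: "nat \<Rightarrow> 'a"
  assume "weakly_null x \<and> (\<lambda>n. norm (x n - T (x n))) \<longlonglongrightarrow> 0"
  then have wn: "weakly_null x" and lim: "(\<lambda>n. x n - T (x n)) \<longlonglongrightarrow> 0"
    by (auto simp: tendsto_norm_zero_iff)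
  show "(\<lambda>n. norm (x n)) \<longlonglongrightarrow> 0"
  proof (rule ccontr)
    assume "\<not> (\<lambda>n. norm (x n)) \<longlonglongrightarrow> 0"
    \<comment> \<open>Failure of the limit gives the lower bound \<open>e\<close> only infinitely
      often; this bound is the predicate that the subsequence has to preserve.\<close>
    then obtain e where e: "e > 0" "\<exists>\<^sub>F n in sequentially. e \<le> norm (x n)"
      by (auto simp: tendsto_iff not_eventually not_less)
    obtain r where r: "strict_mono r" "\<And>n. e \<le> norm (x (r n))"
        and sm: "summable (\<lambda>n. norm (x (r n) - T (x (r n))))"
      using frequently_subseq_summable_norm[OF lim e(2)] by blast
    have "weakly_null (\<lambda>n. x (r n))"
      unfolding weakly_null_def
    proof (intro allI impI)
      fix f :: "'a \<Rightarrow> real"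
      assume "bounded_linear f"
      then have "(\<lambda>n. f (x n)) \<longlonglongrightarrow> 0"
        using wn by (simp add: weakly_null_def)
      from LIMSEQ_subseq_LIMSEQ[OF this r(1)] show "(\<lambda>n. f (x (r n))) \<longlonglongrightarrow> 0"
        by (simp add: o_def)
    qed
    moreover have "uo_converges (\<lambda>n. x (r n) - T (x (r n))) 0 sequentially"
      using sm by (rule uo_converges_0_if_summable_norm)
    ultimately have "(\<lambda>n. norm (x (r n))) \<longlonglongrightarrow> 0"
      using assms by (auto simp: uo_demi_dunford_pettis_def)
    then have "e \<le> 0"
      by (rule LIMSEQ_le_const) (use r(2) in auto)
    with e(1) show False by simp
  qed
qed

end
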